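(* Let $p$ be a prime, let $M,\tilde M\in M_n(\mathbb{Z})$ be expanding integer matrices, and let $D,\tilde D\subset\mathbb{Z}^n$ be finite digit sets. Suppose that $(M,D)$ and $(\tilde M,\tilde D)$ are conjugate in $GL_n(p)$. If $\mathcal{Z}_{\tilde D}^n\subset\mathring{E}_p^n$ or $\mathcal{Z}_{D}^n\subset\mathring{E}_p^n$, then $(M,D)$ is admissible if and only if $(\tilde M,\tilde D)$ is admissible.
   Context: A matrix is expanding if all its eigenvalues have modulus $>1$. Conjugacy: $(M,D)$ and $(\tilde M,\tilde D)$ are conjugate in $GL_n(p)$ (through $A,B$) if there exist two integer matrices $A,B\in M_n(\mathbb{Z})$, whose reductions mod $p$ are invertible (this is what is meant by integer matrices $A,B\in GL_n(p)$), with $AB\equiv I\pmod p$, such that one of the following holds: (i) $\tilde M=AMB$ and $D=B\tilde D$; (ii) $\tilde M=AMB$ and $\tilde D=AD$. Mask polynomial: for a finite $D\subset\mathbb{Z}^n$, $m_D(x)=\frac{1}{|D|}\sum_{d\in D}e^{2\pi i\langle d,x\rangle}$ for $x\in\mathbb{R}^n$; $\mathcal{Z}(m_D)=\{x\in\mathbb{R}^n: m_D(x)=0\}$; $\mathcal{Z}_D^n:=\mathcal{Z}(m_D)\cap[0,1)^n$. For an integer $q\ge2$: $E_q^n:=\frac1q\{(l_1,\dots,l_n)^t: l_i\in\mathbb{Z},\ 0\le l_1,\dots,l_n\le q-1\}$ and $\mathring{E}_q^n:=E_q^n\setminus\{0\}$. Admissibility: for an expanding $M\in M_n(\mathbb{Z})$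 and a finite $D\subset\mathbb{Z}^n$, $(M,D)$ is admissible if there is a finite set $S\subset\mathbb{Z}^n$ with $|S|=|D|$ such that the matrix $H=\frac{1}{\sqrt{|S|}}\left[e^{2\pi i\langle M^{-1}d,s\rangle}\right]_{d\in D,s\in S}$ is unitary. *)

theory Defs
  imports "HOL-Analysis.Analysis" "HOL-Number_Theory.Cong"
begin

definition real_vec :: "int ^ 'n \<Rightarrow> real ^ 'n" where
  "real_vec v = (\<chi> i. real_of_int (v $ i))"

definition complex_eigenvalue :: "int ^ 'n ^ 'n \<Rightarrow> complex \<Rightarrow> bool" where
  "complex_eigenvalue M z \<longleftrightarrow> (\<exists>v::complex ^ 'n. v \<noteq> 0 \<and> map_matrix of_int M *v v = z *s v)"

definition expanding :: "int ^ 'n ^ 'n \<Rightarrow> bool" where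
  "expanding M \<longleftrightarrow> (\<forall>z. complex_eigenvalue M z \<longrightarrow> norm z > 1)"

definition mat_cong :: "nat \<Rightarrow> int ^ 'n ^ 'n \<Rightarrow> int ^ 'n ^ 'n \<Rightarrow> bool" where
  "mat_cong p A B \<longleftrightarrow> (\<forall>i j. [A $ i $ j = B $ i $ j] (mod int p))"

text \<open>An integer matrix whose reduction mod \<open>p\<close> lies in \<open>GL\<^sub>n(p)\<close>; the inverse over
  the residue ring is represented by an integer lift \<open>C\<close>.\<close>

definition invertible_mod :: "nat \<Rightarrow> int ^ 'n ^ 'n \<Rightarrow> bool" where
  "invertible_mod p A \<longleftrightarrow> (\<exists>C. mat_cong p (A ** C) (mat 1) \<and> mat_cong p (C ** A) (mat 1))"

text \<open>The relations between the matrices and digit sets are exact equalities over the integers;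
  only \<open>A ** B\<close> is compared mod \<open>p\<close>.\<close>

definition conjugate_GL ::
  "nat \<Rightarrow> int ^ 'n ^ 'n \<Rightarrow> (int ^ 'n) set \<Rightarrow> int ^ 'n ^ 'n \<Rightarrow> (int ^ 'n) set \<Rightarrow> bool" where
  "conjugate_GL p M D M' D' \<longleftrightarrow>
     (\<exists>A B. invertible_mod p A \<and> invertible_mod p B \<and> mat_cong p (A ** B) (mat 1) \<and>
        ((M' = A ** M ** B \<and> D = (\<lambda>d. B *v d) ` D') \<or>
         (M' = A ** M ** B \<and> D' = (\<lambda>d. A *v d) ` D)))"

definition mask :: "(int ^ 'n) set \<Rightarrow> real ^ 'n \<Rightarrow> complex" where
  "mask D x = 1 / of_nat (card D) * (\<Sum>d\<in>D. exp (2 * of_real pi * \<i> * of_real (real_vec d \<bullet> x)))"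

definition mask_zeros :: "(int ^ 'n) set \<Rightarrow> (real ^ 'n) set" where
  "mask_zeros D = {x. mask D x = 0}"

definition unit_cube :: "(real ^ 'n) set" where
  "unit_cube = {x. \<forall>i. 0 \<le> x $ i \<and> x $ i < 1}"

definition mask_zeros_cube :: "(int ^ 'n) set \<Rightarrow> (real ^ 'n) set" where
  "mask_zeros_cube D = mask_zeros D \<inter> unit_cube"

definition E_grid :: "nat \<Rightarrow> (real ^ 'n) set" where
  "E_grid q = {(1 / real q) *\<^sub>R real_vec l | l. \<forall>i. 0 \<le> l $ i \<and> l $ i \<le> int q - 1}"

definition E_grid0 :: "nat \<Rightarrow> (real ^ 'n) set" where
  "E_grid0 q = E_grid q - {0}"

text \<open>Unitarity of a matrix with rows indexed by \<open>R\<close> and columns indexed by \<open>C\<close>: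
  \<open>H H\<^sup>* = I\<close> and \<open>H\<^sup>* H = I\<close>.\<close>

definition unitary_on :: "'r set \<Rightarrow> 'c set \<Rightarrow> ('r \<Rightarrow> 'c \<Rightarrow> complex) \<Rightarrow> bool" where
  "unitary_on R C H \<longleftrightarrow>
     (\<forall>r\<in>R. \<forall>r'\<in>R. (\<Sum>c\<in>C. H r c * cnj (H r' c)) = (if r = r' then 1 else 0)) \<and>
     (\<forall>c\<in>C. \<forall>c'\<in>C. (\<Sum>r\<in>R. cnj (H r c) * H r c') = (if c = c' then 1 else 0))"

text \<open>Meant for expanding \<open>M\<close> (hence invertible over the reals) and finite \<open>D\<close>.\<close>

definition admissible :: "int ^ 'n ^ 'n \<Rightarrow> (int ^ 'n) set \<Rightarrow> bool" where
  "admissible M D \<longleftrightarrow>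
     (\<exists>S::(int ^ 'n) set. finite S \<and> card S = card D \<and>
        unitary_on D S (\<lambda>d s. 1 / of_real (sqrt (real (card S))) *
          exp (2 * of_real pi * \<i> *
            of_real ((matrix_inv (map_matrix real_of_int M) *v real_vec d) \<bullet> real_vec s))))"

end

theory Submission
  imports Defs
begin

text \<open>
  Write \<open>M\<^sup>T\<close> for the transpose of \<open>M\<close>. A set \<open>S\<close> witnesses admissibility of \<open>(M, D)\<close> iff
  \<open>|S| = |D|\<close> and every difference \<open>\<sigma>\<close> of distinct elements of \<open>S\<close> has the form \<open>M\<^sup>T x\<close> with
  \<open>x\<close> a zero of the mask polynomial of \<open>D\<close>: these are the orthogonality relations between
  columns, and for as many columns as rows they already give unitarity
  (\<open>admissible_iff_mask\<close>). Admissibility therefore passes from one pair to another as soon as some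
  real linear map \<open>F\<close> sends the integral vectors \<open>M\<^sup>T x\<close> with \<open>x\<close> a zero to integral vectors of the
  same kind for the other pair: translate \<open>S\<close> to contain the origin and apply \<open>F\<close>
  (\<open>admissible_transfer\<close>).

  Let \<open>M' = A M B\<close>, so \<open>M'\<^sup>T = B\<^sup>T M\<^sup>T A\<^sup>T\<close>. If \<open>D = B D'\<close>, then \<open>x\<close> is a zero for \<open>D\<close> iff
  \<open>B\<^sup>T x\<close> is one for \<open>D'\<close>. Zeros \<open>x\<close> for \<open>D\<close> are sent to \<open>B\<^sup>T x\<close>. Conversely, zeros \<open>y\<close> for \<open>D'\<close> are
  sent to \<open>A\<^sup>T y\<close>, because \<open>B\<^sup>T A\<^sup>T y\<close> and \<open>y\<close> differ by an integral vector: \<open>A B\<close> is \<open>I + p K\<close>, and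
  \<open>p y\<close> is integral by the grid hypothesis. If \<open>D' = A D\<close>, then \<open>A\<^sup>T\<close> itself identifies the zeros
  for \<open>D'\<close> with those for \<open>D\<close>. In each case the differences \<open>\<sigma>\<close> are related by a fixed rational
  matrix, and what has to be checked is that the new ones are integral. Where that matrix is not
  itself integral, the grid hypothesis makes \<open>p\<close> times each of them integral, and Cramer's rule does
  the same for \<open>det B\<close>, which is coprime to \<open>p\<close> (\<open>integral_vec_det_scale\<close>,
  \<open>coprime_det_if_invertible_mod\<close>).

  The grid hypothesis enters as integrality of \<open>p\<close> times every zero for the digit set whose image is
  the other one. If it is given for the image instead, it passes back
  (\<open>mask_zeros_grid_preimage\<close>).
\<close>

section \<open>Unitarity from orthonormal columns\<close>

text \<open>
  With \<open>P = H H\<^sup>*\<close>, the column relations give \<open>tr P = tr (P P\<^sup>*) = |C|\<close>. As \<open>|C| = |R|\<close>, the squared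
  Frobenius norm of \<open>P - I\<close> is \<open>tr (P P\<^sup>*) - 2 tr P + |R| = 0\<close>, so \<open>P = I\<close>.
\<close>

lemma unitary_on_if_orthonormal_columns:
  fixes H :: "'r \<Rightarrow> 'c \<Rightarrow> complex"
  assumes fin: "finite R" "finite C" and card: "card R = card C"
    and cols: "\<forall>c\<in>C. \<forall>c'\<in>C. (\<Sum>r\<in>R. cnj (H r c) * H r c') = (if c = c' then 1 else 0)"
  shows "unitary_on R C H"
proof -
  define P where "P r r' = (\<Sum>c\<in>C. H r c * cnj (H r' c))" for r r'
  define \<delta> :: "'r \<Rightarrow> 'r \<Rightarrow> complex" where "\<delta> r r' = (if r = r' then 1 else 0)" for r r'
  have "(\<Sum>r\<in>R. P r r) = (\<Sum>c\<in>C. \<Sum>r\<in>R. cnj (H r c) * H r c)"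
    unfolding P_def by (subst sum.swap) (simp add: mult.commute)
  also have "\<dots> = of_nat (card C)"
    using cols by simp
  finally have trace: "(\<Sum>r\<in>R. P r r) = of_nat (card R)"
    using card by simp
  have "(\<Sum>r\<in>R. \<Sum>r'\<in>R. P r r' * cnj (P r r')) =
      (\<Sum>r\<in>R. \<Sum>r'\<in>R. \<Sum>c\<in>C. \<Sum>c'\<in>C. (cnj (H r c') * H r c) * (cnj (H r' c) * H r' c'))"
    unfolding P_def by (simp add: sum_product mult_ac)
  also have "\<dots> = (\<Sum>r\<in>R. \<Sum>c\<in>C. \<Sum>c'\<in>C. \<Sum>r'\<in>R. (cnj (H r c') * H r c) * (cnj (H r' c) * H r' c'))"
    by (intro sum.cong refl, subst sum.swap, intro sum.cong refl, subst sum.swap, rule refl)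
  also have "\<dots> = (\<Sum>r\<in>R. \<Sum>c\<in>C. \<Sum>c'\<in>C. (cnj (H r c') * H r c) * (if c = c' then 1 else 0))"
    using cols by (intro sum.cong refl) (simp add: sum_distrib_left[symmetric])
  also have "\<dots> = (\<Sum>r\<in>R. \<Sum>c\<in>C. cnj (H r c) * H r c)"
    using fin by (simp add: sum.delta if_distrib cong: if_cong)
  also have "\<dots> = of_nat (card R)"
    using trace unfolding P_def by (simp add: mult.commute)
  finally have frob: "(\<Sum>r\<in>R. \<Sum>r'\<in>R. P r r' * cnj (P r r')) = of_nat (card R)" .
  have diag: "(\<Sum>r\<in>R. \<Sum>r'\<in>R. f r r' * \<delta> r r') = (\<Sum>r\<in>R. f r r)"
    "(\<Sum>r\<in>R. \<Sum>r'\<in>R. \<delta> r r') = of_nat (card R)" for f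
    using fin by (simp_all add: \<delta>_def if_distrib cong: if_cong)
  have "of_real (\<Sum>r\<in>R. \<Sum>r'\<in>R. (cmod (P r r' - \<delta> r r'))\<^sup>2) =
      (\<Sum>r\<in>R. \<Sum>r'\<in>R. P r r' * cnj (P r r') - P r r' * \<delta> r r'
         - cnj (P r r') * \<delta> r r' + \<delta> r r')"
    unfolding of_real_sum complex_norm_square
    by (intro sum.cong refl) (auto simp: \<delta>_def algebra_simps)
  also have "\<dots> = of_nat (card R) - (\<Sum>r\<in>R. P r r) - (\<Sum>r\<in>R. cnj (P r r)) + of_nat (card R)"
    by (simp only: sum.distrib sum_subtractf frob diag)
  also have "\<dots> = 0"
    unfolding cnj_sum[symmetric] trace by simp
  finally have "(\<Sum>r\<in>R. \<Sum>r'\<in>R. (cmod (P r r' - \<delta> r r'))\<^sup>2) = 0"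
    using of_real_eq_0_iff by blast
  then have "\<forall>r\<in>R. \<forall>r'\<in>R. P r r' = \<delta> r r'"
    using fin by (simp add: sum_nonneg_eq_0_iff sum_nonneg)
  then show ?thesis
    using cols unfolding unitary_on_def P_def \<delta>_def by simp
qed

section \<open>Integer matrices acting on real vectors\<close>

text \<open>
  The transpose of \<open>A\<close> acting on \<open>x\<close>, which is how \<open>A\<close> acts on the frequency variable of mask
  polynomials.
\<close>

definition dual_act :: "int ^ 'n ^ 'm \<Rightarrow> real ^ 'm \<Rightarrow> real ^ 'n" where
  "dual_act A x = x v* map_matrix real_of_int A"

lemma linear_dual_act: "linear (dual_act A)"
  unfolding dual_act_def transpose_matrix_vector[symmetric] by (rule matrix_vector_mul_linear)

lemmas dual_act_add = linear_add[OF linear_dual_act]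
  and dual_act_scale = linear_scale[OF linear_dual_act]

lemma map_matrix_of_int_mult:
  "map_matrix of_int (A ** B) = map_matrix of_int A ** (map_matrix of_int B :: 'a::ring_1 ^ _ ^ _)"
  by (simp add: vec_eq_iff matrix_matrix_mult_def)

lemma dual_act_mult: "dual_act (A ** B) x = dual_act B (dual_act A x)"
  unfolding dual_act_def map_matrix_of_int_mult by (simp add: vector_matrix_mul_assoc)

lemma det_map_matrix_of_int:
  "det (map_matrix of_int A :: 'a::comm_ring_1 ^ 'n ^ 'n) = of_int (det A)"
  by (simp add: det_def)

lemma bij_dual_act:
  fixes A :: "int ^ 'n ^ 'n"
  assumes "det A \<noteq> 0"
  shows "bij (dual_act A)"
proof -
  let ?A = "transpose (map_matrix real_of_int A)"
  have "det ?A \<noteq> 0"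
    using assms by (simp add: det_map_matrix_of_int)
  then have "invertible ?A"
    by (simp add: invertible_det_nz)
  then have "bij ((*v) ?A)"
    by (simp add: invertible_eq_bij)
  moreover have "(*v) ?A = dual_act A"
    by (simp add: fun_eq_iff dual_act_def)
  ultimately show ?thesis by simp
qed

lemma inner_real_vec_dual_act:
  "real_vec (A *v d) \<bullet> x = real_vec d \<bullet> dual_act A x"
proof -
  have "real_vec (A *v d) = map_matrix real_of_int A *v real_vec d"
    by (simp add: vec_eq_iff real_vec_def matrix_vector_mult_def)
  then show ?thesis
    unfolding dual_act_def by (metis dot_lmul_matrix inner_commute)
qed

text \<open>A singular matrix has the eigenvalue 0.\<close>

lemma expanding_det_nonzero:
  fixes M :: "int ^ 'n ^ 'n"
  assumes "expanding M"
  shows "det M \<noteq> 0"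
proof
  assume "det M = 0"
  then have "det (map_matrix of_int M :: complex ^ 'n ^ 'n) = 0"
    by (simp add: det_map_matrix_of_int)
  then have "\<not> invertible (map_matrix of_int M :: complex ^ 'n ^ 'n)"
    by (simp add: invertible_det_nz)
  then obtain v :: "complex ^ 'n" where "v \<noteq> 0" "map_matrix of_int M *v v = 0"
    unfolding invertible_left_inverse matrix_left_invertible_ker by blast
  then have "complex_eigenvalue M 0"
    unfolding complex_eigenvalue_def by (intro exI[of _ v]) simp
  then show False
    using assms unfolding expanding_def by fastforce
qed

section \<open>Integral vectors\<close>

definition integral_vec :: "real ^ 'n \<Rightarrow> bool" where
  "integral_vec x \<longleftrightarrow> (\<forall>i. x $ i \<in> \<int>)"

lemma integral_vec_iff_real_vec: "integral_vec x \<longleftrightarrow> (\<exists>v. x = real_vec v)"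
proof
  assume "integral_vec x"
  then have "x = real_vec (\<chi> i. \<lfloor>x $ i\<rfloor>)"
    by (simp add: integral_vec_def real_vec_def vec_eq_iff)
  then show "\<exists>v. x = real_vec v" by blast
qed (auto simp: integral_vec_def real_vec_def)

lemma real_vec_diff: "real_vec (u - v) = real_vec u - real_vec v"
  by (simp add: real_vec_def vec_eq_iff)

lemma real_vec_inj: "real_vec u = real_vec v \<longleftrightarrow> u = v"
  by (simp add: real_vec_def vec_eq_iff)

lemma integral_vec_add: "integral_vec x \<Longrightarrow> integral_vec y \<Longrightarrow> integral_vec (x + y)"
  and integral_vec_diff: "integral_vec x \<Longrightarrow> integral_vec y \<Longrightarrow> integral_vec (x - y)"
  and integral_vec_scale: "a \<in> \<int> \<Longrightarrow> integral_vec x \<Longrightarrow> integral_vec (a *\<^sub>R x)"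
  by (simp_all add: integral_vec_def)

lemma integral_vec_dual_act: "integral_vec x \<Longrightarrow> integral_vec (dual_act A x)"
  by (simp add: integral_vec_def dual_act_def vector_matrix_mult_def Ints_sum)

lemma integral_vec_if_coprime_multiples:
  fixes a b :: int
  assumes "coprime a b"
    and "integral_vec (of_int a *\<^sub>R x)" "integral_vec (of_int b *\<^sub>R x)"
  shows "integral_vec x"
proof -
  obtain u v where uv: "u * a + v * b = 1"
    using bezout_int[of a b] assms(1) by auto
  have "x = real_of_int (u * a + v * b) *\<^sub>R x"
    unfolding uv by simp
  also have "\<dots> = of_int u *\<^sub>R (of_int a *\<^sub>R x) + of_int v *\<^sub>R (of_int b *\<^sub>R x)"
    by (simp add: scaleR_add_left)
  finally show ?thesis
    using assms by (metis Ints_of_int integral_vec_add integral_vec_scale)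
qed

text \<open>
  By Cramer's rule, \<open>det A\<close> is a common denominator for the solutions of an integral system.
\<close>

lemma integral_vec_det_scale:
  fixes A :: "int ^ 'n ^ 'n"
  assumes "integral_vec (dual_act A x)"
  shows "integral_vec (of_int (det A) *\<^sub>R x)"
proof (cases "det A = 0")
  case False
  let ?A = "transpose (map_matrix real_of_int A)"
  have d: "det ?A = of_int (det A)"
    by (simp add: det_map_matrix_of_int)
  have nz: "det ?A \<noteq> 0"
    using False d by simp
  define N where "N k = (\<chi> i j. if j = k then dual_act A x $ i else ?A $ i $ j)" for k
  have x: "x = (\<chi> k. det (N k) / det ?A)"
    unfolding N_def by (subst cramer[OF nz, symmetric]) (simp add: dual_act_def)
  have "det (N k) \<in> \<int>" for k
    unfolding det_def using assms
    by (intro Ints_sum Ints_mult Ints_prod Ints_of_int)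
       (auto simp: N_def integral_vec_def transpose_def)
  moreover have "(of_int (det A) *\<^sub>R x) $ k = det (N k)" for k
    using False d by (subst x) simp
  ultimately show ?thesis
    by (simp add: integral_vec_def)
qed (simp add: integral_vec_def)

section \<open>Matrices modulo p\<close>

lemma mat_cong_mult:
  assumes "mat_cong p A A'" "mat_cong p B B'"
  shows "mat_cong p (A ** B) (A' ** B')"
  using assms unfolding mat_cong_def matrix_matrix_mult_def
  by (auto intro!: cong_sum cong_mult)

lemma mat_cong_refl: "mat_cong p A A"
  by (simp add: mat_cong_def)

lemma mat_cong_sym: "mat_cong p A B \<Longrightarrow> mat_cong p B A"
  by (auto simp: mat_cong_def intro: cong_sym)

lemma mat_cong_trans: "mat_cong p A B \<Longrightarrow> mat_cong p B C \<Longrightarrow> mat_cong p A C"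
  unfolding mat_cong_def using cong_trans by blast

lemma mat_cong_det:
  assumes "mat_cong p A B"
  shows "[det A = det B] (mod int p)"
  using assms unfolding mat_cong_def det_def
  by (intro cong_sum cong_mult cong_prod) auto

lemma coprime_det_if_invertible_mod:
  fixes A :: "int ^ 'n ^ 'n"
  assumes "invertible_mod p A"
  shows "coprime (det A) (int p)"
proof -
  obtain C where "mat_cong p (A ** C) (mat 1)"
    using assms unfolding invertible_mod_def by blast
  then have "[det A * det C = 1] (mod int p)"
    using mat_cong_det by (fastforce simp: det_mul)
  then show ?thesis
    using coprime_iff_invertible_int by blast
qed

text \<open>An inverse \<open>C\<close> of \<open>A\<close> modulo \<open>p\<close> is congruent to \<open>C A B\<close>, hence to \<open>B\<close>.\<close>

lemma mat_cong_inverse_commute: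
  assumes "invertible_mod p A" "mat_cong p (A ** B) (mat 1)"
  shows "mat_cong p (B ** A) (mat 1)"
proof -
  obtain C where C: "mat_cong p (C ** A) (mat 1)"
    using assms(1) unfolding invertible_mod_def by blast
  have "mat_cong p (C ** (A ** B)) (C ** mat 1)"
    by (intro mat_cong_mult mat_cong_refl assms)
  moreover have "mat_cong p ((C ** A) ** B) (mat 1 ** B)"
    by (intro mat_cong_mult mat_cong_refl C)
  ultimately have "mat_cong p B C"
    by (metis mat_cong_sym mat_cong_trans matrix_mul_assoc matrix_mul_lid matrix_mul_rid)
  then show ?thesis
    using C by (metis mat_cong_mult mat_cong_refl mat_cong_trans)
qed

text \<open>
  Here \<open>C = I + p K\<close>; the factor \<open>p\<close> is kept with the vector because \<open>p x\<close> is integral in all uses.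
\<close>

lemma dual_act_cong_one:
  assumes "mat_cong p C (mat 1)"
  obtains K where "\<And>x. dual_act C x = x + dual_act K (real p *\<^sub>R x)"
proof -
  define K where "K = (\<chi> i j. (C $ i $ j - mat 1 $ i $ j) div int p)"
  have "C $ i $ j = mat 1 $ i $ j + int p * K $ i $ j" for i j
  proof -
    have "int p dvd C $ i $ j - mat 1 $ i $ j"
      using assms by (simp add: mat_cong_def cong_iff_dvd_diff)
    then show ?thesis
      by (simp add: K_def)
  qed
  then have entry: "x * of_int (C $ i $ j) =
      x * of_int (mat 1 $ i $ j) + (real p * x) * of_int (K $ i $ j)" for x i j
    by (simp add: algebra_simps)
  have "dual_act C x = x + dual_act K (real p *\<^sub>R x)" for x
  proof -
    have "(\<Sum>i\<in>UNIV. x $ i * of_int (mat 1 $ i $ j)) = x $ j" for j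
      by (simp add: mat_def if_distrib cong: if_cong)
    then show ?thesis
      by (simp add: vec_eq_iff dual_act_def vector_matrix_mult_def entry sum.distrib mult.commute)
  qed
  then show ?thesis using that by blast
qed

lemma integral_vec_if_dual_act:
  assumes "invertible_mod p A"
    and "integral_vec (dual_act A x)" "integral_vec (real p *\<^sub>R x)"
  shows "integral_vec x"
proof -
  have "integral_vec (of_int (det A) *\<^sub>R x)"
    using assms(2) by (rule integral_vec_det_scale)
  then show ?thesis
    using integral_vec_if_coprime_multiples[OF coprime_det_if_invertible_mod[OF assms(1)]] assms(3)
    by simp
qed

section \<open>Zeros of mask polynomials\<close>

lemma mask_zero_nonzero:
  assumes "finite D" "D \<noteq> {}"
  shows "mask D 0 \<noteq> 0"
  using assms by (simp add: mask_def)

lemma mask_add_integral_vec: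
  assumes "integral_vec y"
  shows "mask D (x + y) = mask D x"
proof -
  have "exp (2 * of_real pi * \<i> * of_real (real_vec d \<bullet> (x + y))) =
      exp (2 * of_real pi * \<i> * of_real (real_vec d \<bullet> x))" for d
  proof -
    have "real_vec d \<bullet> y \<in> \<int>"
      using assms by (simp add: inner_vec_def real_vec_def integral_vec_def Ints_sum)
    then obtain k where "real_vec d \<bullet> y = of_int k"
      by (auto elim: Ints_cases)
    then show ?thesis
      using exp_plus_2pin[of "2 * of_real pi * \<i> * of_real (real_vec d \<bullet> x)" k]
      by (simp add: inner_add_right algebra_simps)
  qed
  then show ?thesis
    by (simp add: mask_def)
qed

lemma mask_image:
  assumes "det A \<noteq> 0"
  shows "mask ((\<lambda>d. A *v d) ` D) x = mask D (dual_act A x)"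
    and "card ((\<lambda>d. A *v d) ` D) = card D"
proof -
  have inj: "inj_on (\<lambda>d. A *v d) D"
  proof (rule inj_onI)
    fix d e assume de: "A *v d = A *v e"
    have "real_vec d \<bullet> dual_act A x = real_vec e \<bullet> dual_act A x" for x
      using de by (metis inner_real_vec_dual_act)
    then have "real_vec d \<bullet> y = real_vec e \<bullet> y" for y
      using bij_dual_act[OF assms] by (metis bij_pointE)
    then show "d = e"
      by (metis real_vec_inj vector_eq_rdot)
  qed
  then show "card ((\<lambda>d. A *v d) ` D) = card D"
    by (rule card_image)
  then show "mask ((\<lambda>d. A *v d) ` D) x = mask D (dual_act A x)"
    by (simp add: mask_def sum.reindex[OF inj] inner_real_vec_dual_act)
qed

text \<open>
  Mask polynomials are periodic under the integer lattice, so their zeros in the unit cube control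
  all zeros.
\<close>

lemma mask_zero_in_grid:
  assumes "mask_zeros_cube D \<subseteq> E_grid0 p" "mask D x = 0"
  shows "integral_vec (real p *\<^sub>R x)"
proof -
  define z where "z = (\<chi> i. - real_of_int \<lfloor>x $ i\<rfloor>)"
  have z: "integral_vec z"
    by (simp add: z_def integral_vec_def)
  have "mask D (x + z) = 0"
    using assms(2) by (simp add: mask_add_integral_vec[OF z])
  moreover have "0 \<le> (x + z) $ i \<and> (x + z) $ i < 1" for i
    unfolding z_def vector_add_component vec_lambda_beta by linarith
  ultimately have "x + z \<in> mask_zeros_cube D"
    by (simp add: mask_zeros_cube_def mask_zeros_def unit_cube_def)
  then have "x + z \<in> E_grid p"
    using assms(1) by (auto simp: E_grid0_def)
  then obtain l where "x + z = (1 / real p) *\<^sub>R real_vec l"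
    by (auto simp: E_grid_def)
  then have "integral_vec (real p *\<^sub>R (x + z))"
    by (cases "p = 0") (auto simp: integral_vec_def real_vec_def)
  moreover have "integral_vec (real p *\<^sub>R z)"
    using z by (simp add: integral_vec_scale)
  ultimately show ?thesis
    using integral_vec_diff by (fastforce simp: scaleR_add_right)
qed

text \<open>
  Every zero \<open>w\<close> for \<open>D\<close> is the image, under the transpose of \<open>A\<close>, of a zero for \<open>A D\<close>.
\<close>

lemma mask_zeros_grid_preimage:
  fixes A :: "int ^ 'n ^ 'n"
  assumes "det A \<noteq> 0"
    and grid: "\<And>x. mask ((\<lambda>d. A *v d) ` D) x = 0 \<Longrightarrow> integral_vec (real p *\<^sub>R x)"
    and "mask D w = 0"
  shows "integral_vec (real p *\<^sub>R w)"
proof -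
  obtain x where x: "dual_act A x = w"
    using bij_dual_act[OF assms(1)] by (metis bij_pointE)
  then have "integral_vec (real p *\<^sub>R x)"
    using assms(3) by (intro grid) (simp add: mask_image[OF assms(1)])
  then show ?thesis
    using x by (metis dual_act_scale integral_vec_dual_act)
qed

section \<open>Admissibility through mask zeros\<close>

text \<open>
  The inner product of the columns of \<open>s\<close> and \<open>s'\<close> is the value of the mask polynomial at
  \<open>x\<close>, the solution of \<open>M\<^sup>T x = s' - s\<close>. Phrasing this with \<open>x\<close> keeps the inverse of \<open>M\<close> out of all
  later arguments.
\<close>

lemma admissible_iff_mask:
  fixes M :: "int ^ 'n ^ 'n"
  assumes "finite D" "det M \<noteq> 0"
  shows "admissible M D \<longleftrightarrow>
    (\<exists>S. finite S \<and> card S = card D \<and>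
      (\<forall>s\<in>S. \<forall>s'\<in>S. s \<noteq> s' \<longrightarrow> (\<exists>x. dual_act M x = real_vec s' - real_vec s \<and> mask D x = 0)))"
proof -
  let ?H = "\<lambda>S d s. 1 / of_real (sqrt (real (card S))) *
          exp (2 * of_real pi * \<i> *
            of_real ((matrix_inv (map_matrix real_of_int M) *v real_vec d) \<bullet> real_vec s)) :: complex"
  have "invertible (map_matrix real_of_int M)"
    using assms(2) by (simp add: invertible_det_nz det_map_matrix_of_int)
  then have right_inv: "map_matrix real_of_int M ** matrix_inv (map_matrix real_of_int M) = mat 1"
    unfolding invertible_def matrix_inv_def by (metis (mono_tags, lifting) someI_ex)
  have ip: "(matrix_inv (map_matrix real_of_int M) *v v) \<bullet> dual_act M x = v \<bullet> x" for v x
  proof -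
    have "(matrix_inv (map_matrix real_of_int M) *v v) \<bullet> dual_act M x =
        x \<bullet> (map_matrix real_of_int M *v (matrix_inv (map_matrix real_of_int M) *v v))"
      unfolding dual_act_def by (metis dot_lmul_matrix inner_commute)
    then show ?thesis
      by (simp add: matrix_vector_mul_assoc right_inv inner_commute)
  qed
  have col: "(\<Sum>d\<in>D. cnj (?H S d s) * ?H S d s') = mask D x"
    if "card S = card D" "dual_act M x = real_vec s' - real_vec s" for S s s' x
  proof -
    have "cnj (?H S d s) * ?H S d s' = 1 / of_nat (card D) *
        exp (2 * of_real pi * \<i> * of_real (real_vec d \<bullet> x))" for d
    proof -
      let ?v = "matrix_inv (map_matrix real_of_int M) *v real_vec d"
      let ?c = "2 * of_real pi * \<i> :: complex"
      have diff: "real_vec d \<bullet> x = ?v \<bullet> real_vec s' - ?v \<bullet> real_vec s"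
        using ip[of "real_vec d" x] that(2) by (simp add: inner_diff_right)
      have "exp (?c * of_real (real_vec d \<bullet> x)) =
          cnj (exp (?c * of_real (?v \<bullet> real_vec s))) * exp (?c * of_real (?v \<bullet> real_vec s'))"
        unfolding diff by (simp add: exp_cnj exp_add[symmetric] algebra_simps)
      moreover have "complex_of_real (sqrt (real (card D))) * of_real (sqrt (real (card D))) =
          of_nat (card D)"
        by (metis abs_of_nat of_real_mult of_real_of_nat_eq real_sqrt_mult_self)
      ultimately show ?thesis
        using that(1) by simp
    qed
    then show ?thesis
      by (simp add: mask_def sum_distrib_left)
  qed
  have surj: "\<exists>x. dual_act M x = y" for y
    using bij_dual_act[OF assms(2)] by (metis bij_pointE)
  have "unitary_on D S (?H S) \<longleftrightarrow>
      (\<forall>s\<in>S. \<forall>s'\<in>S. s \<noteq> s' \<longrightarrow> (\<exists>x. dual_act M x = real_vec s' - real_vec s \<and> mask D x = 0))"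
    (is "_ \<longleftrightarrow> ?R")
    if S: "finite S" "card S = card D" for S
  proof
    assume U: "unitary_on D S (?H S)"
    show ?R
    proof (intro ballI impI)
      fix s s' assume s: "s \<in> S" "s' \<in> S" "s \<noteq> s'"
      obtain x where x: "dual_act M x = real_vec s' - real_vec s"
        using surj by blast
      have "(\<Sum>d\<in>D. cnj (?H S d s) * ?H S d s') = 0"
        using U s unfolding unitary_on_def by auto
      then have "mask D x = 0"
        using col[OF S(2) x] by simp
      with x show "\<exists>x. dual_act M x = real_vec s' - real_vec s \<and> mask D x = 0"
        by blast
    qed
  next
    assume R: ?R
    have "(\<Sum>d\<in>D. cnj (?H S d s) * ?H S d s') = (if s = s' then 1 else 0)"
      if s: "s \<in> S" "s' \<in> S" for s s'
    proof (cases "s = s'")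
      case True
      have "card D \<noteq> 0"
        using S s by (metis card_0_eq empty_iff)
      moreover have "dual_act M 0 = real_vec s' - real_vec s"
        using True by (simp add: linear_0[OF linear_dual_act])
      ultimately show ?thesis
        using col[OF S(2), of 0 s' s] True by (simp add: mask_def)
    next
      case False
      then obtain x where "dual_act M x = real_vec s' - real_vec s" "mask D x = 0"
        using R s by blast
      then show ?thesis
        using col[OF S(2)] False by simp
    qed
    then show "unitary_on D S (?H S)"
      using S assms(1) by (intro unitary_on_if_orthonormal_columns) auto
  qed
  then show ?thesis
    unfolding admissible_def by (intro ex_cong1) blast
qed

text \<open>
  Integrality is known for the images of differences only, so the new set consists of the vectors
  \<open>F (s - s0)\<close> for a base point \<open>s0\<close> of \<open>S\<close>. They are distinct because two equal ones would make 0 a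
  mask zero of \<open>D'\<close>.
\<close>

lemma admissible_transfer:
  fixes M M' :: "int ^ 'n ^ 'n" and F :: "real ^ 'n \<Rightarrow> real ^ 'n"
  assumes "finite D" "finite D'" "card D = card D'" "det M \<noteq> 0" "det M' \<noteq> 0"
    and lin: "linear F"
    and zeros: "\<And>x. integral_vec (dual_act M x) \<Longrightarrow> mask D x = 0 \<Longrightarrow>
      \<exists>y. dual_act M' y = F (dual_act M x) \<and> integral_vec (dual_act M' y) \<and> mask D' y = 0"
    and "admissible M D"
  shows "admissible M' D'"
proof -
  obtain S where S: "finite S" "card S = card D"
    and orth: "\<And>s s'. s \<in> S \<Longrightarrow> s' \<in> S \<Longrightarrow> s \<noteq> s' \<Longrightarrow>
      \<exists>x. dual_act M x = real_vec s' - real_vec s \<and> mask D x = 0"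
    using assms(8) unfolding admissible_iff_mask[OF assms(1,4)] by blast
  have step: "\<exists>y. dual_act M' y = F (real_vec s' - real_vec s) \<and> integral_vec (dual_act M' y) \<and> mask D' y = 0"
    if s: "s \<in> S" "s' \<in> S" "s \<noteq> s'" for s s'
  proof -
    obtain x where x: "dual_act M x = real_vec s' - real_vec s" "mask D x = 0"
      using orth s by blast
    moreover have "integral_vec (dual_act M x)"
      using x by (metis integral_vec_iff_real_vec real_vec_diff)
    ultimately show ?thesis
      using zeros[of x] by simp
  qed
  show ?thesis
  proof (cases "S = {}")
    case True
    then have "finite {}" "card {} = card D'"
      using S assms(3) by simp_all
    then show ?thesis
      unfolding admissible_iff_mask[OF assms(2,5)] by blast
  next
    case False
    then obtain s0 where s0: "s0 \<in> S" by blast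
    have "\<exists>t. real_vec t = F (real_vec s - real_vec s0)" if "s \<in> S" for s
    proof (cases "s = s0")
      case True
      then have "real_vec 0 = F (real_vec s - real_vec s0)"
        by (simp add: linear_0[OF lin] real_vec_def vec_eq_iff)
      then show ?thesis by blast
    next
      case False
      then show ?thesis
        using step[OF s0 that] by (metis integral_vec_iff_real_vec)
    qed
    then obtain g where g: "\<And>s. s \<in> S \<Longrightarrow> real_vec (g s) = F (real_vec s - real_vec s0)"
      by metis
    have diff: "real_vec (g s') - real_vec (g s) = F (real_vec s' - real_vec s)"
      if "s \<in> S" "s' \<in> S" for s s'
      using that by (simp add: g linear_diff[OF lin])
    have pair: "\<exists>y. dual_act M' y = real_vec (g s') - real_vec (g s) \<and> mask D' y = 0"
      if s: "s \<in> S" "s' \<in> S" "s \<noteq> s'" for s s'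
      using step[OF s] diff[OF s(1,2)] by auto
    have "D' \<noteq> {}"
      using S False assms(2,3) by auto
    have "inj_on g S"
    proof (rule inj_onI, rule ccontr)
      fix s s' assume s: "s \<in> S" "s' \<in> S" "g s = g s'" "s \<noteq> s'"
      then obtain y where y: "dual_act M' y = 0" "mask D' y = 0"
        using pair[of s s'] by auto
      then have "y = 0"
        using bij_dual_act[OF assms(5)] linear_0[OF linear_dual_act]
        by (metis bij_is_inj injD)
      then show False
        using y mask_zero_nonzero[OF assms(2) \<open>D' \<noteq> {}\<close>] by simp
    qed
    then have "finite (g ` S)" "card (g ` S) = card D'"
      using S assms(3) by (simp_all add: card_image)
    moreover have "\<forall>t\<in>g ` S. \<forall>t'\<in>g ` S. t \<noteq> t' \<longrightarrow>
        (\<exists>y. dual_act M' y = real_vec t' - real_vec t \<and> mask D' y = 0)"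
      using pair by blast
    ultimately show ?thesis
      unfolding admissible_iff_mask[OF assms(2,5)] by blast
  qed
qed

section \<open>Conjugate pairs\<close>

context
  fixes p :: nat and A B M :: "int ^ 'n ^ 'n" and D D' :: "(int ^ 'n) set"
  assumes detA: "det A \<noteq> 0" and detB: "det B \<noteq> 0" and detM: "det M \<noteq> 0"
    and invA: "invertible_mod p A" and invB: "invertible_mod p B"
    and AB: "mat_cong p (A ** B) (mat 1)"
    and fin: "finite D" "finite D'"
begin

lemma det_conjugate: "det (A ** M ** B) \<noteq> 0"
  using detA detB detM by (simp add: det_mul)

lemma dual_act_conjugate: "dual_act (A ** M ** B) y = dual_act B (dual_act M (dual_act A y))"
  by (simp add: dual_act_mult)

lemma linear_inv_dual_act: "linear (inv (dual_act B))"
  by (intro inj_linear_imp_inv_linear linear_dual_act bij_is_inj bij_dual_act detB)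

lemma inv_dual_act: "inv (dual_act B) (dual_act B x) = x"
  using bij_dual_act[OF detB] by (simp add: bij_is_inj)

text \<open>
  In the passage from \<open>A M B\<close> back to \<open>M\<close>, the new difference \<open>M\<^sup>T A\<^sup>T y\<close> becomes the old, integral
  one when \<open>B\<^sup>T\<close> is applied to it, and its multiple by \<open>p\<close> is integral by the grid hypothesis.
\<close>

lemma integral_vec_unconjugate:
  assumes "integral_vec (dual_act (A ** M ** B) y)"
    and "integral_vec (real p *\<^sub>R dual_act A y)"
  shows "integral_vec (dual_act M (dual_act A y))"
proof (rule integral_vec_if_dual_act[OF invB])
  show "integral_vec (dual_act B (dual_act M (dual_act A y)))"
    using assms(1) by (simp add: dual_act_conjugate)
  show "integral_vec (real p *\<^sub>R dual_act M (dual_act A y))"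
    using integral_vec_dual_act[OF assms(2), of M] by (simp add: dual_act_scale)
qed

text \<open>
  Zeros \<open>x\<close> for \<open>D\<close> go to \<open>B\<^sup>T x\<close>. The grid hypothesis concerns \<open>B\<^sup>T x\<close>, not \<open>x\<close>, so only
  \<open>p det B x\<close> is known to be integral; this is enough, \<open>det B\<close> being coprime to \<open>p\<close>.
\<close>

lemma admissible_conjugate_if_image_B:
  assumes D: "D = (\<lambda>d. B *v d) ` D'"
    and grid: "\<And>w. mask D' w = 0 \<Longrightarrow> integral_vec (real p *\<^sub>R w)"
    and "admissible M D"
  shows "admissible (A ** M ** B) D'"
proof -
  have cards: "card D = card D'"
    by (simp add: D mask_image(2)[OF detB])
  obtain K where K: "\<And>x. dual_act A (dual_act B x) = x + dual_act K (real p *\<^sub>R x)"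
    using dual_act_cong_one[OF mat_cong_inverse_commute[OF invA AB]] by (auto simp: dual_act_mult)
  let ?F = "dual_act (A ** M ** B) \<circ> dual_act B \<circ> inv (dual_act M)"
  have "\<exists>y. dual_act (A ** M ** B) y = ?F (dual_act M x) \<and>
      integral_vec (dual_act (A ** M ** B) y) \<and> mask D' y = 0"
    if x: "integral_vec (dual_act M x)" "mask D x = 0" for x
  proof (intro exI conjI)
    show zero: "mask D' (dual_act B x) = 0"
      using x(2) by (simp add: D mask_image[OF detB])
    show "dual_act (A ** M ** B) (dual_act B x) = ?F (dual_act M x)"
      using bij_dual_act[OF detM] by (simp add: bij_is_inj)
    let ?t = "dual_act (A ** M ** B) (dual_act B x)"
    have w: "integral_vec (dual_act B (real p *\<^sub>R x))"
      using grid[OF zero] by (simp add: dual_act_scale)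
    show "integral_vec ?t"
    proof (rule integral_vec_if_coprime_multiples[OF coprime_det_if_invertible_mod[OF invB]])
      show "integral_vec (of_int (int p) *\<^sub>R ?t)"
        using integral_vec_dual_act[OF w, of "A ** M ** B"] by (simp add: dual_act_scale)
      \<comment> \<open>\<open>B\<^sup>T M\<^sup>T A\<^sup>T B\<^sup>T x = B\<^sup>T M\<^sup>T x + B\<^sup>T M\<^sup>T K\<^sup>T (p x)\<close>, whose first summand is integral.\<close>
      have "integral_vec (of_int (det B) *\<^sub>R (real p *\<^sub>R x))"
        using w by (rule integral_vec_det_scale)
      then have "integral_vec (dual_act B (dual_act M (dual_act K (of_int (det B) *\<^sub>R (real p *\<^sub>R x)))))"
        by (intro integral_vec_dual_act)
      moreover have "integral_vec (of_int (det B) *\<^sub>R dual_act B (dual_act M x))"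
        by (rule integral_vec_scale[OF Ints_of_int integral_vec_dual_act[OF x(1)]])
      moreover have "?t = dual_act B (dual_act M x) + dual_act B (dual_act M (dual_act K (real p *\<^sub>R x)))"
        by (simp add: dual_act_conjugate K dual_act_add)
      ultimately show "integral_vec (of_int (det B) *\<^sub>R ?t)"
        by (simp add: dual_act_scale scaleR_add_right integral_vec_add)
    qed
  qed
  moreover have "linear ?F"
    by (intro linear_compose linear_dual_act inj_linear_imp_inv_linear bij_is_inj bij_dual_act detM)
  ultimately show ?thesis
    using assms(3) by (intro admissible_transfer[OF fin cards detM det_conjugate, of ?F])
qed

text \<open>
  Zeros \<open>y\<close> for \<open>D'\<close> go to \<open>A\<^sup>T y\<close>, which is a zero for \<open>D\<close> by periodicity: \<open>B\<^sup>T A\<^sup>T y\<close> and \<open>y\<close> agree modulo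
  integral vectors.
\<close>

lemma admissible_if_conjugate_image_B:
  assumes D: "D = (\<lambda>d. B *v d) ` D'"
    and grid: "\<And>w. mask D' w = 0 \<Longrightarrow> integral_vec (real p *\<^sub>R w)"
    and "admissible (A ** M ** B) D'"
  shows "admissible M D"
proof -
  have cards: "card D' = card D"
    by (simp add: D mask_image(2)[OF detB])
  obtain K where K: "\<And>y. dual_act B (dual_act A y) = y + dual_act K (real p *\<^sub>R y)"
    using dual_act_cong_one[OF AB] by (auto simp: dual_act_mult)
  have "\<exists>x. dual_act M x = inv (dual_act B) (dual_act (A ** M ** B) y) \<and>
      integral_vec (dual_act M x) \<and> mask D x = 0"
    if y: "integral_vec (dual_act (A ** M ** B) y)" "mask D' y = 0" for y
  proof (intro exI conjI)
    show "dual_act M (dual_act A y) = inv (dual_act B) (dual_act (A ** M ** B) y)"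
      by (simp add: dual_act_conjugate inv_dual_act)
    show "integral_vec (dual_act M (dual_act A y))"
      using integral_vec_dual_act[OF grid[OF y(2)], of A]
      by (intro integral_vec_unconjugate[OF y(1)]) (simp add: dual_act_scale)
    have "mask D' (dual_act B (dual_act A y)) = mask D' y"
      unfolding K by (intro mask_add_integral_vec integral_vec_dual_act grid y)
    then show "mask D (dual_act A y) = 0"
      using y(2) by (simp add: D mask_image[OF detB])
  qed
  then show ?thesis
    by (intro admissible_transfer[OF fin(2,1) cards det_conjugate detM linear_inv_dual_act _ assms(3)])
qed

text \<open>
  \<open>A\<^sup>T\<close> matches the two zero sets exactly, and the differences are multiplied by the integer matrix
  \<open>B\<^sup>T\<close>, so integrality is automatic.
\<close>

lemma admissible_conjugate_if_image_A:
  assumes D': "D' = (\<lambda>d. A *v d) ` D" and "admissible M D"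
  shows "admissible (A ** M ** B) D'"
proof -
  have cards: "card D = card D'"
    by (simp add: D' mask_image(2)[OF detA])
  have "\<exists>y. dual_act (A ** M ** B) y = dual_act B (dual_act M x) \<and>
      integral_vec (dual_act (A ** M ** B) y) \<and> mask D' y = 0"
    if x: "integral_vec (dual_act M x)" "mask D x = 0" for x
  proof -
    obtain y where y: "dual_act A y = x"
      using bij_dual_act[OF detA] by (metis bij_pointE)
    then show ?thesis
      using x by (intro exI[of _ y])
        (auto simp: D' mask_image[OF detA] dual_act_conjugate intro: integral_vec_dual_act)
  qed
  then show ?thesis
    by (intro admissible_transfer[OF fin cards detM det_conjugate linear_dual_act _ assms(2)])
qed

lemma admissible_if_conjugate_image_A:
  assumes D': "D' = (\<lambda>d. A *v d) ` D"
    and grid: "\<And>w. mask D w = 0 \<Longrightarrow> integral_vec (real p *\<^sub>R w)"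
    and "admissible (A ** M ** B) D'"
  shows "admissible M D"
proof -
  have cards: "card D' = card D"
    by (simp add: D' mask_image(2)[OF detA])
  have "\<exists>x. dual_act M x = inv (dual_act B) (dual_act (A ** M ** B) y) \<and>
      integral_vec (dual_act M x) \<and> mask D x = 0"
    if y: "integral_vec (dual_act (A ** M ** B) y)" "mask D' y = 0" for y
  proof (intro exI conjI)
    show "dual_act M (dual_act A y) = inv (dual_act B) (dual_act (A ** M ** B) y)"
      by (simp add: dual_act_conjugate inv_dual_act)
    show zero: "mask D (dual_act A y) = 0"
      using y(2) by (simp add: D' mask_image[OF detA])
    show "integral_vec (dual_act M (dual_act A y))"
      by (intro integral_vec_unconjugate y(1) grid zero)
  qed
  then show ?thesis
    by (intro admissible_transfer[OF fin(2,1) cards det_conjugate detM linear_inv_dual_act _ assms(3)])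
qed

end

theorem theorem1p5:
  fixes p :: nat
    and M M' :: "int ^ 'n ^ 'n"
    and D D' :: "(int ^ 'n) set"
  assumes "prime p"
    and "expanding M" and "expanding M'"
    and "finite D" and "finite D'"
    and "conjugate_GL p M D M' D'"
    and "mask_zeros_cube D' \<subseteq> E_grid0 p \<or> mask_zeros_cube D \<subseteq> E_grid0 p"
  shows "admissible M D \<longleftrightarrow> admissible M' D'"
proof -
  obtain A B where AB: "invertible_mod p A" "invertible_mod p B" "mat_cong p (A ** B) (mat 1)"
    and M': "M' = A ** M ** B"
    and DD': "D = (\<lambda>d. B *v d) ` D' \<or> D' = (\<lambda>d. A *v d) ` D"
    using assms(6) unfolding conjugate_GL_def by blast
  have "det A * det M * det B \<noteq> 0"
    using expanding_det_nonzero[OF assms(3)] by (simp add: M' det_mul)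
  then have det: "det A \<noteq> 0" "det B \<noteq> 0" "det M \<noteq> 0"
    by auto
  note ctxt = det AB assms(4,5)
  have grid: "(\<forall>w. mask D' w = 0 \<longrightarrow> integral_vec (real p *\<^sub>R w)) \<or>
      (\<forall>w. mask D w = 0 \<longrightarrow> integral_vec (real p *\<^sub>R w))"
    using assms(7) mask_zero_in_grid by blast
  from DD' show ?thesis
  proof
    assume D: "D = (\<lambda>d. B *v d) ` D'"
    have "\<And>w. mask D' w = 0 \<Longrightarrow> integral_vec (real p *\<^sub>R w)"
      using grid mask_zeros_grid_preimage[OF det(2)] D by blast
    then show ?thesis
      unfolding M'
      using admissible_conjugate_if_image_B[OF ctxt D] admissible_if_conjugate_image_B[OF ctxt D] by blast
  next
    assume D': "D' = (\<lambda>d. A *v d) ` D"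
    have "\<And>w. mask D w = 0 \<Longrightarrow> integral_vec (real p *\<^sub>R w)"
      using grid mask_zeros_grid_preimage[OF det(1)] D' by blast
    then show ?thesis
      unfolding M'
      using admissible_conjugate_if_image_A[OF ctxt D'] admissible_if_conjugate_image_A[OF ctxt D'] by blast
  qed
qed

end
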